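(* If $A\subseteq\mathbb{N}$ is an $IP^{\star}$ set and $B\subseteq\mathbb{N}$ is an $IP$ set, then \[ \mathbb{Q}_{>0}=\frac{A}{B}=\{a/b:\ a\in A,\ b\in B\}. \]
   Context: $\mathbb{N}$ denotes the positive integers and $\mathbb{Q}_{>0}$ the positive rationals. For a sequence $\langle x_n\rangle_{n\in\mathbb{N}}$ in $\mathbb{N}$, $FS(\langle x_n\rangle_{n\in\mathbb{N}})=\{\sum_{t\in F}x_t:\ F\text{ a nonempty finite subset of }\mathbb{N}\}$. A set is an $IP$ set if it equals $FS(\langle x_n\rangle)$ for some sequence in $\mathbb{N}$. A set $A\subseteq\mathbb{N}$ is an $IP^{\star}$ set if it intersects every $IP$ set. *)

theory Defs
  imports Complex_Main
begin

text \<open>The positive integers are represented by the subset \<open>{0<..}\<close> of type \<open>nat\<close>, both for the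
  values and for the indices of sequences; the value of a sequence at index 0 is irrelevant.\<close>

definition FS :: "(nat \<Rightarrow> nat) \<Rightarrow> nat set" where
  "FS x = {\<Sum>t\<in>F. x t | F. finite F \<and> F \<noteq> {} \<and> F \<subseteq> {0<..}}"

definition IP_set :: "nat set \<Rightarrow> bool" where
  "IP_set B \<longleftrightarrow> (\<exists>x. (\<forall>n>0. x n > 0) \<and> B = FS x)"

definition IP_star_set :: "nat set \<Rightarrow> bool" where
  "IP_star_set A \<longleftrightarrow> A \<subseteq> {0<..} \<and> (\<forall>B. IP_set B \<longrightarrow> A \<inter> B \<noteq> {})"

definition quotient_set :: "nat set \<Rightarrow> nat set \<Rightarrow> rat set" where
  "quotient_set A B = {of_nat a / of_nat b | a b. a \<in> A \<and> b \<in> B}"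

end

theory Submission
  imports Defs "HOL-Library.Infinite_Set"
begin

text \<open>Among the partial sums of \<open>x\<close>, infinitely many agree modulo \<open>n\<close>; the differences of consecutive
  ones generate an IP subset of \<open>FS x\<close> consisting of multiples of \<open>n\<close>. Scaling this subset by \<open>m / n\<close>
  gives an IP set of integers, and any point \<open>a\<close> where \<open>A\<close> meets it satisfies \<open>a = (m / n) b\<close>
  with \<open>b \<in> FS x\<close>.\<close>

lemma ex_FS_subset_multiples:
  fixes x :: "nat \<Rightarrow> nat" and n :: nat
  assumes pos: "\<And>i. i > 0 \<Longrightarrow> x i > 0" and n: "n > 0"
  obtains y where "\<And>i. y i > 0" and "\<And>i. n dvd y i" and "FS y \<subseteq> FS x"
proof -
  define S where "S k = sum x {0<..k}" for k
  have "finite ((\<lambda>k. S k mod n) ` UNIV)"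
    by (rule finite_subset[of _ "{..<n}"]) (use n in auto)
  then obtain k0 where "infinite {k \<in> UNIV. S k mod n = S k0 mod n}"
    using pigeonhole_infinite[of UNIV "\<lambda>k. S k mod n"] by blast
  then obtain r :: "nat \<Rightarrow> nat" where r: "strict_mono r"
    and res: "\<And>i. S (r i) mod n = S k0 mod n"
    using infinite_enumerate by blast
  \<comment> \<open>The left end is excluded, so consecutive blocks share no index, and index 0
    never occurs even if \<open>r 0 = 0\<close>.\<close>
  define G where "G i = {r i<..r (Suc i)}" for i
  define y where "y i = sum x (G i)" for i
  have lt: "r i < r (Suc i)" for i
    using r by (simp add: strict_mono_Suc_iff)
  have G: "finite (G i)" "G i \<noteq> {}" "G i \<subseteq> {0<..}" for i
    using lt[of i] by (auto simp: G_def)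
  have disj: "G i \<inter> G j = {}" if "i < j" for i j
  proof -
    have "r (Suc i) \<le> r j"
      using r that by (simp add: strict_mono_less_eq)
    then show ?thesis by (auto simp: G_def)
  qed
  have "y i > 0" for i
    unfolding y_def
  proof (rule sum_pos[OF G(1,2)])
    show "x t > 0" if "t \<in> G i" for t
      using that G(3)[of i] by (intro pos) auto
  qed
  moreover have "n dvd y i" for i
  proof -
    have "{0<..r (Suc i)} = {0<..r i} \<union> G i" "{0<..r i} \<inter> G i = {}"
      using lt[of i] by (auto simp: G_def)
    then have "S (r (Suc i)) = S (r i) + y i"
      unfolding S_def y_def by (simp add: sum.union_disjoint G(1))
    \<comment> \<open>Equal residues give divisibility when the subtrahend is the smaller term;
      otherwise the truncated difference is 0.\<close>
    moreover have "n dvd S (r (Suc i)) - S (r i)"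
      using res[of i] res[of "Suc i"] by (metis mod_eq_dvd_iff_nat nat_le_linear diff_is_0_eq dvd_0_right)
    ultimately show ?thesis by simp
  qed
  moreover have "FS y \<subseteq> FS x"
  proof
    fix s assume "s \<in> FS y"
    then obtain F where F: "finite F" "F \<noteq> {}" and s: "s = sum y F"
      by (auto simp: FS_def)
    \<comment> \<open>Disjoint blocks count no \<open>x t\<close> twice, so a finite sum of terms of
      \<open>y\<close> is a sum of \<open>x\<close> over one finite index set.\<close>
    have "s = sum x (\<Union>i\<in>F. G i)"
      unfolding s y_def
      by (rule sum.UNION_disjoint[symmetric]) (use F(1) G(1) disj in \<open>auto simp: neq_iff\<close>)
    moreover have "finite (\<Union>i\<in>F. G i)" "(\<Union>i\<in>F. G i) \<noteq> {}" "(\<Union>i\<in>F. G i) \<subseteq> {0<..}"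
      using F G by auto
    ultimately show "s \<in> FS x"
      unfolding FS_def by blast
  qed
  ultimately show thesis by (rule that)
qed

theorem mainTheorem10:
  fixes A B :: "nat set"
  assumes "A \<subseteq> {0<..}" and "B \<subseteq> {0<..}"
    and "IP_star_set A" and "IP_set B"
  shows "{q :: rat. q > 0} = quotient_set A B"
proof
  show "quotient_set A B \<subseteq> {q. q > 0}"
    using assms(1,2) by (fastforce simp: quotient_set_def)
  show "{q. q > 0} \<subseteq> quotient_set A B"
  proof clarify
    fix q :: rat assume "q > 0"
    obtain k l where kl: "quotient_of q = (k, l)" by fastforce
    \<comment> \<open>\<open>nat\<close> loses nothing here: \<open>l\<close> is positive as a
      normalized denominator, and then \<open>k\<close> is positive because \<open>q\<close>
      is.\<close>
    define m n where "m = nat k" and "n = nat l"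
    have "l > 0" using quotient_of_denom_pos[OF kl] .
    moreover have ql: "q = of_int k / of_int l" using quotient_of_div[OF kl] .
    ultimately have "k > 0"
      using \<open>q > 0\<close> by (simp add: zero_less_divide_iff)
    then have mn: "m > 0" "n > 0" and q: "q = of_nat m / of_nat n"
      using \<open>l > 0\<close> ql by (simp_all add: m_def n_def)
    obtain x where "\<And>i. i > 0 \<Longrightarrow> x i > 0" and B: "B = FS x"
      using assms(4) by (auto simp: IP_set_def)
    then obtain y where y: "\<And>i. y i > 0" "\<And>i. n dvd y i" "FS y \<subseteq> B"
      using ex_FS_subset_multiples[of x n] mn(2) by metis
    \<comment> \<open>The division is exact because \<open>n\<close> divides \<open>y i\<close>, so
      this is \<open>y i\<close> scaled by \<open>m / n\<close> without leaving the
      naturals.\<close>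
    define z where "z i = m * (y i div n)" for i
    have ny: "n * z i = m * y i" for i
      using y(2)[of i] by (simp add: z_def mult.left_commute)
    have "z i > 0" for i
      using ny[of i] y(1)[of i] mn by (metis mult_is_0 neq0_conv)
    then have "IP_set (FS z)"
      unfolding IP_set_def by (intro exI[of _ z]) simp
    then obtain a where a: "a \<in> A" "a \<in> FS z"
      using assms(3) by (auto simp: IP_star_set_def)
    then obtain F where F: "finite F" "F \<noteq> {}" "F \<subseteq> {0<..}" "a = sum z F"
      by (auto simp: FS_def)
    \<comment> \<open>Reusing the index set \<open>F\<close> that produced \<open>a\<close> allows
      \<open>ny\<close> to be summed term by term.\<close>
    define b where "b = sum y F"
    have "b \<in> B"
      using F y(3) by (auto simp: FS_def b_def)
    have "n * a = m * b"
      by (simp add: F(4) b_def sum_distrib_left ny)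
    then have "of_nat n * of_nat a = (of_nat m * of_nat b :: rat)"
      by (metis of_nat_mult)
    \<comment> \<open>Division by 0 yields 0 in \<open>rat\<close>, so clearing denominators
      requires a nonzero \<open>b\<close>.\<close>
    moreover have "b > 0" using \<open>b \<in> B\<close> assms(2) by auto
    ultimately have "q = of_nat a / of_nat b"
      using mn by (simp add: q field_simps)
    then show "q \<in> quotient_set A B"
      using a(1) \<open>b \<in> B\<close> by (auto simp: quotient_set_def)
  qed
qed

end
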